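(* Let $T$ be a set and $\mathrm{wt}:T\to[0,\infty)$ a function, let $F_T$ be the group freely generated by $T$, and let $\|\cdot\|$ be the weighted cancellation norm on $F_T$. Let $m$ be a nonnegative integer. For every group element $w\in F_T$ represented by a word (over $T\cup T^{-1}$) of length at most $2^m$, we have $$\|w\|\le\frac{m+1}{2}\,\|w^2\|.$$
   Context: Let $S=T\sqcup T^{-1}\subset F_T$, with $\mathrm{wt}(t^{-1})=\mathrm{wt}(t)$ for $t\in T$. Two disjoint pairs $\{i,j\}$, $\{k,r\}$ with $i<j$, $k<r$ are linked if $i<k<j<r$ or $k<i<r<j$. A folding of a word $l_1\cdots l_n$ over $S$ is a collection $\mathcal F$ of pairwise disjoint two-element subsets of $\{1,\dots,n\}$ such that $l_i=l_j^{-1}$ for every $\{i,j\}\in\mathcal F$ and no two pairs of $\mathcal F$ are linked. A position is unpaired in $\mathcal F$ if it belongs to no pair of $\mathcal F$. The weighted cancellation norm of the word is the minimum over all its foldings of $\sum\mathrm{wt}(l_i)$ over unpaired positions $i$. For $g\in F_T$, $\|g\|$ is the weighted cancellation norm of any word over $S$ representing $g$ (this is independent of the word). *)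

theory Defs
  imports Complex_Main "HOL-Algebra.Group"
begin

text \<open>
  A letter of \<open>S = T \<squnion> T\<^sup>-\<^sup>1\<close> is \<open>Inl t\<close> for \<open>t\<close> and \<open>Inr t\<close> for
  \<open>t\<^sup>-\<^sup>1\<close>. Positions in a word are counted from 0, as for HOL lists.
\<close>

definition letters :: "'a set \<Rightarrow> ('a + 'a) set" where
  "letters T = T <+> T"

definition inv_letter :: "'a + 'a \<Rightarrow> 'a + 'a" where
  "inv_letter = case_sum Inr Inl"

definition wt_letter :: "('a \<Rightarrow> real) \<Rightarrow> 'a + 'a \<Rightarrow> real" where
  "wt_letter wt = case_sum wt wt"

inductive_set free_eq :: "'a set \<Rightarrow> (('a + 'a) list \<times> ('a + 'a) list) set" for T where
  cancel: "\<lbrakk>u \<in> lists (letters T); x \<in> letters T; v \<in> lists (letters T)\<rbrakk>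
    \<Longrightarrow> (u @ [x, inv_letter x] @ v, u @ v) \<in> free_eq T"
| refl: "u \<in> lists (letters T) \<Longrightarrow> (u, u) \<in> free_eq T"
| sym: "(u, v) \<in> free_eq T \<Longrightarrow> (v, u) \<in> free_eq T"
| trans: "(u, v) \<in> free_eq T \<Longrightarrow> (v, w) \<in> free_eq T \<Longrightarrow> (u, w) \<in> free_eq T"

text \<open>The element of the free group represented by a word.\<close>

definition word_class :: "'a set \<Rightarrow> ('a + 'a) list \<Rightarrow> ('a + 'a) list set" where
  "word_class T u = free_eq T `` {u}"

definition free_group :: "'a set \<Rightarrow> ('a + 'a) list set monoid" where
  "free_group T =
    \<lparr>carrier = lists (letters T) // free_eq T,
     mult = (\<lambda>g h. \<Union>u\<in>g. \<Union>v\<in>h. word_class T (u @ v)),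
     one = word_class T []\<rparr>"

definition linked :: "nat set \<Rightarrow> nat set \<Rightarrow> bool" where
  "linked P Q \<longleftrightarrow> (\<exists>i j k r. P = {i, j} \<and> Q = {k, r} \<and> i < j \<and> k < r \<and>
     (i < k \<and> k < j \<and> j < r \<or> k < i \<and> i < r \<and> r < j))"

definition folding :: "('a + 'a) list \<Rightarrow> nat set set \<Rightarrow> bool" where
  "folding l F \<longleftrightarrow>
     (\<forall>P\<in>F. P \<subseteq> {..<length l} \<and> card P = 2) \<and>
     pairwise disjnt F \<and>
     (\<forall>i j. {i, j} \<in> F \<longrightarrow> l ! i = inv_letter (l ! j)) \<and>
     (\<forall>P\<in>F. \<forall>Q\<in>F. \<not> linked P Q)"

definition unpaired :: "('a + 'a) list \<Rightarrow> nat set set \<Rightarrow> nat set" where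
  "unpaired l F = {..<length l} - \<Union>F"

definition word_norm :: "('a \<Rightarrow> real) \<Rightarrow> ('a + 'a) list \<Rightarrow> real" where
  "word_norm wt l = Min {\<Sum>i\<in>unpaired l F. wt_letter wt (l ! i) | F. folding l F}"

text \<open>
  The elements of \<open>g\<close> are the words representing it. The word norm is the same for all of them,
  so the choice of representative is immaterial.
\<close>

definition cancellation_norm :: "('a \<Rightarrow> real) \<Rightarrow> ('a + 'a) list set \<Rightarrow> real" where
  "cancellation_norm wt g = word_norm wt (SOME u. u \<in> g)"

lemma inv_letter_inv_letter [simp]: "inv_letter (inv_letter x) = x"
  by (cases x) (simp_all add: inv_letter_def)

lemma inv_letter_in_letters [simp]: "inv_letter x \<in> letters T \<longleftrightarrow> x \<in> letters T"
  by (cases x) (auto simp: inv_letter_def letters_def)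

lemma free_eq_in_lists:
  "(u, v) \<in> free_eq T \<Longrightarrow> u \<in> lists (letters T) \<and> v \<in> lists (letters T)"
  by (induction rule: free_eq.induct) auto

lemma equiv_free_eq: "equiv (lists (letters T)) (free_eq T)"
proof (rule equivI)
  show "free_eq T \<subseteq> lists (letters T) \<times> lists (letters T)"
    by (rule subrelI, drule free_eq_in_lists) blast
  show "refl_on (lists (letters T)) (free_eq T)"
    by (rule refl_onI) (rule free_eq.refl)
  show "sym (free_eq T)"
    by (rule symI) (rule free_eq.sym)
  show "trans (free_eq T)"
    by (rule transI) (rule free_eq.trans)
qed

lemma free_eq_append_right:
  "(u, v) \<in> free_eq T \<Longrightarrow> w \<in> lists (letters T) \<Longrightarrow> (u @ w, v @ w) \<in> free_eq T"
proof (induction rule: free_eq.induct)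
  case (cancel u x v)
  then show ?case using free_eq.cancel[of u T x "v @ w"] by simp
next
  case (refl u)
  then show ?case by (simp add: free_eq.refl)
qed (blast intro: free_eq.sym, blast intro: free_eq.trans)

lemma free_eq_append_left:
  "(u, v) \<in> free_eq T \<Longrightarrow> w \<in> lists (letters T) \<Longrightarrow> (w @ u, w @ v) \<in> free_eq T"
proof (induction rule: free_eq.induct)
  case (cancel u x v)
  then show ?case using free_eq.cancel[of "w @ u" T x v] by simp
next
  case (refl u)
  then show ?case by (simp add: free_eq.refl)
qed (blast intro: free_eq.sym, blast intro: free_eq.trans)

lemma free_eq_append:
  assumes "(u, u') \<in> free_eq T" "(v, v') \<in> free_eq T"
  shows "(u @ v, u' @ v') \<in> free_eq T"
proof (rule free_eq.trans)
  show "(u @ v, u' @ v) \<in> free_eq T"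
    using assms(1) free_eq_in_lists[OF assms(2)] by (blast intro: free_eq_append_right)
  show "(u' @ v, u' @ v') \<in> free_eq T"
    using assms(2) free_eq_in_lists[OF assms(1)] by (blast intro: free_eq_append_left)
qed

lemma word_class_eq_iff:
  "u \<in> lists (letters T) \<Longrightarrow> v \<in> lists (letters T) \<Longrightarrow>
    word_class T u = word_class T v \<longleftrightarrow> (u, v) \<in> free_eq T"
  unfolding word_class_def using eq_equiv_class_iff[OF equiv_free_eq] by blast

lemma carrier_free_group: "carrier (free_group T) = word_class T ` lists (letters T)"
  by (auto simp: free_group_def quotient_def word_class_def)

lemma one_free_group: "\<one>\<^bsub>free_group T\<^esub> = word_class T []"
  by (simp add: free_group_def)

lemma mult_free_group:
  assumes "u \<in> lists (letters T)" "v \<in> lists (letters T)"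
  shows "word_class T u \<otimes>\<^bsub>free_group T\<^esub> word_class T v = word_class T (u @ v)"
proof -
  have "word_class T (u' @ v') = word_class T (u @ v)"
    if "u' \<in> word_class T u" "v' \<in> word_class T v" for u' v'
  proof -
    have "(u @ v, u' @ v') \<in> free_eq T"
      using that by (simp add: word_class_def free_eq_append)
    from free_eq_in_lists[OF this] this show ?thesis
      by (metis word_class_eq_iff)
  qed
  moreover have "u \<in> word_class T u" "v \<in> word_class T v"
    using assms by (simp_all add: word_class_def free_eq.refl)
  ultimately have "(\<Union>u'\<in>word_class T u. \<Union>v'\<in>word_class T v. word_class T (u' @ v')) =
      word_class T (u @ v)"
    by blast
  then show ?thesis
    by (simp add: free_group_def)
qed

lemma free_eq_inverse:
  "u \<in> lists (letters T) \<Longrightarrow> (rev (map inv_letter u) @ u, []) \<in> free_eq T"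
proof (induction u)
  case Nil
  then show ?case by (simp add: free_eq.refl)
next
  case (Cons x u)
  then have "(rev (map inv_letter u) @ [inv_letter x, inv_letter (inv_letter x)] @ u,
      rev (map inv_letter u) @ u) \<in> free_eq T"
    by (intro free_eq.cancel) (simp_all add: in_lists_conv_set)
  then have "(rev (map inv_letter (x # u)) @ x # u, rev (map inv_letter u) @ u) \<in> free_eq T"
    by simp
  moreover have "(rev (map inv_letter u) @ u, []) \<in> free_eq T"
    using Cons by simp
  ultimately show ?case by (rule free_eq.trans)
qed

lemma group_free_group: "group (free_group T)"
proof (rule groupI)
  show "\<one>\<^bsub>free_group T\<^esub> \<in> carrier (free_group T)"
    by (simp add: carrier_free_group one_free_group)
next
  fix g h assume "g \<in> carrier (free_group T)" "h \<in> carrier (free_group T)"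
  then obtain u v where "u \<in> lists (letters T)" "g = word_class T u"
      "v \<in> lists (letters T)" "h = word_class T v"
    unfolding carrier_free_group by blast
  then show "g \<otimes>\<^bsub>free_group T\<^esub> h \<in> carrier (free_group T)"
    by (simp add: carrier_free_group mult_free_group)
next
  fix g h k
  assume "g \<in> carrier (free_group T)" "h \<in> carrier (free_group T)" "k \<in> carrier (free_group T)"
  then obtain u v w where "u \<in> lists (letters T)" "g = word_class T u"
      "v \<in> lists (letters T)" "h = word_class T v" "w \<in> lists (letters T)" "k = word_class T w"
    unfolding carrier_free_group by blast
  then show "g \<otimes>\<^bsub>free_group T\<^esub> h \<otimes>\<^bsub>free_group T\<^esub> k = g \<otimes>\<^bsub>free_group T\<^esub> (h \<otimes>\<^bsub>free_group T\<^esub> k)"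
    by (simp add: mult_free_group)
next
  fix g assume "g \<in> carrier (free_group T)"
  then obtain u where u: "u \<in> lists (letters T)" "g = word_class T u"
    unfolding carrier_free_group by blast
  then show "\<one>\<^bsub>free_group T\<^esub> \<otimes>\<^bsub>free_group T\<^esub> g = g"
    by (simp add: one_free_group mult_free_group)
  let ?v = "rev (map inv_letter u)"
  have v: "?v \<in> lists (letters T)"
    using u(1) by (simp add: in_lists_conv_set)
  have "word_class T ?v \<otimes>\<^bsub>free_group T\<^esub> g = \<one>\<^bsub>free_group T\<^esub>"
    unfolding u(2) one_free_group mult_free_group[OF v u(1)]
    using free_eq_inverse[OF u(1)] u v by (subst word_class_eq_iff) simp_all
  with v show "\<exists>h\<in>carrier (free_group T). h \<otimes>\<^bsub>free_group T\<^esub> g = \<one>\<^bsub>free_group T\<^esub>"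
    unfolding carrier_free_group by blast
qed

end

theory Submission
  imports Defs
begin

text \<open>
  Draw an optimal folding of \<open>uu\<close> as noncrossing chords of a circle with \<open>2n\<close> points, where
  \<open>n\<close> is the length of \<open>u\<close>. Cutting the circle along a diameter leaves two copies of a rotation
  of \<open>u\<close>. If \<open>w\<close> is the word of the letters in the first copy whose chords cross the diameter,
  then folding the remaining chords takes the two copies to \<open>w\<close> and \<open>w\<^sup>-\<^sup>1\<close>, at a total cost of
  \<open>\<parallel>u\<^sup>2\<parallel>\<close>. Hence \<open>\<parallel>w\<^sup>2\<parallel> \<le> \<parallel>u\<^sup>2\<parallel>\<close> and \<open>\<parallel>u\<parallel> \<le> \<parallel>w\<parallel> + \<parallel>u\<^sup>2\<parallel> / 2\<close>. Two diameters cut the circle into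
  four arcs. Since chords do not cross, at most one pair of opposite arcs is joined by chords, and
  counting the endpoints on these two arcs shows that one of the diameters is crossed by at most
  \<open>\<lceil>n / 2\<rceil>\<close> chords. So the bound follows by induction on \<open>m\<close>.
\<close>

section \<open>Formal inverses of words\<close>

definition inv_word :: "('a + 'a) list \<Rightarrow> ('a + 'a) list" where
  "inv_word u = rev (map inv_letter u)"

lemma inv_word_simps [simp]:
  "inv_word [] = []"
  "inv_word (x # u) = inv_word u @ [inv_letter x]"
  "inv_word (u @ v) = inv_word v @ inv_word u"
  "inv_word (inv_word u) = u"
  "length (inv_word u) = length u"
  by (simp_all add: inv_word_def rev_map map_idI)

lemma inv_letter_neq: "inv_letter x \<noteq> x"
  by (cases x) (simp_all add: inv_letter_def)

lemma wt_letter_inv [simp]: "wt_letter wt (inv_letter x) = wt_letter wt x"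
  by (cases x) (simp_all add: inv_letter_def wt_letter_def)

section \<open>Partial foldings as contractions of words\<close>

text \<open>
  \<open>contracts wt v u c\<close> encodes a folding of a part of \<open>v\<close> with unpaired weight \<open>c\<close> that leaves
  the letters of \<open>u\<close>. It is generated by insertions into \<open>u\<close> so that cases where two modifications
  of a word overlap stay local.
\<close>

inductive contracts :: "('a \<Rightarrow> real) \<Rightarrow> ('a + 'a) list \<Rightarrow> ('a + 'a) list \<Rightarrow> real \<Rightarrow> bool"
  for wt where
  self: "contracts wt u u 0"
| letter: "contracts wt (p @ q) u c \<Longrightarrow> contracts wt (p @ x # q) u (c + wt_letter wt x)"
| pair: "contracts wt (p @ q) u c \<Longrightarrow> contracts wt (p @ x # inv_letter x # q) u c"

lemma contracts_length: "contracts wt v u c \<Longrightarrow> length u \<le> length v"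
  by (induction rule: contracts.induct) auto

lemma contracts_trans:
  "contracts wt w v c \<Longrightarrow> contracts wt v u d \<Longrightarrow> contracts wt w u (c + d)"
proof (induction rule: contracts.induct)
  case (letter p q u c x)
  then show ?case using contracts.letter[of wt p q _ "c + d" x] by (simp add: add_ac)
qed (auto intro: contracts.intros)

lemma contracts_append_left: "contracts wt v u c \<Longrightarrow> contracts wt (w @ v) (w @ u) c"
proof (induction rule: contracts.induct)
  case (letter p q u c x)
  then show ?case using contracts.letter[of wt "w @ p" q] by simp
next
  case (pair p q u c x)
  then show ?case using contracts.pair[of wt "w @ p" q] by simp
qed (auto intro: contracts.intros)

lemma contracts_append_right: "contracts wt v u c \<Longrightarrow> contracts wt (v @ w) (u @ w) c"
proof (induction rule: contracts.induct)
  case (letter p q u c x)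
  then show ?case using contracts.letter[of wt p "q @ w"] by simp
next
  case (pair p q u c x)
  then show ?case using contracts.pair[of wt p "q @ w"] by simp
qed (auto intro: contracts.intros)

lemma contracts_append:
  "contracts wt v u c \<Longrightarrow> contracts wt v' u' c' \<Longrightarrow> contracts wt (v @ v') (u @ u') (c + c')"
  by (blast intro: contracts_trans contracts_append_left contracts_append_right)

lemma contracts_inv_word: "contracts wt v u c \<Longrightarrow> contracts wt (inv_word v) (inv_word u) c"
proof (induction rule: contracts.induct)
  case (letter p q u c x)
  then show ?case using contracts.letter[of wt "inv_word q" "inv_word p" _ _ "inv_letter x"] by simp
next
  case (pair p q u c x)
  then show ?case using contracts.pair[of wt "inv_word q" "inv_word p" _ _ x] by simp
qed (auto intro: contracts.intros)

lemma contracts_inverse: "contracts wt (u @ inv_word u) [] 0"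
proof (induction u rule: rev_induct)
  case (snoc x u)
  then show ?case using contracts.pair[of wt u "inv_word u"] by simp
qed (simp add: contracts.self)

text \<open>After both factors are contracted, \<open>b\<close> meets its inverse, and the two fold
  onto each other in nested pairs at no cost.\<close>

lemma contracts_cancel:
  assumes "contracts wt v (u @ b) c" "contracts wt v' (inv_word b @ u') c'"
  shows "contracts wt (v @ v') (u @ u') (c + c')"
proof -
  have "contracts wt (u @ b @ inv_word b @ u') (u @ u') 0"
    using contracts_append_left[OF contracts_append_right[OF contracts_inverse[of wt b], of u'], of u]
    by simp
  with contracts_append[OF assms] show ?thesis
    using contracts_trans by fastforce
qed

section \<open>Cutting a contraction at a point of the word\<close>

text \<open>Here \<open>b\<close> consists of the letters of \<open>p\<close> that are paired with letters of \<open>q\<close>.\<close>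

lemma contracts_splitE:
  assumes "contracts wt (p @ q) u c"
  obtains u1 u2 b c1 c2 where "u = u1 @ u2" "contracts wt p (u1 @ b) c1"
    "contracts wt q (inv_word b @ u2) c2" "c = c1 + c2"
proof -
  have "\<exists>u1 u2 b c1 c2. u = u1 @ u2 \<and> contracts wt p (u1 @ b) c1 \<and>
      contracts wt q (inv_word b @ u2) c2 \<and> c = c1 + c2"
    if "contracts wt l u c" "l = p @ q" for l
    using that
  proof (induction arbitrary: p q rule: contracts.induct)
    case (self u)
    then have "u = p @ q \<and> contracts wt p (p @ []) 0 \<and> contracts wt q (inv_word [] @ q) 0 \<and> (0::real) = 0 + 0"
      by (simp add: contracts.self)
    then show ?case by blast
  next
    case (letter p' q' u c x)
    from letter.prems consider r where "p = p' @ x # r" "q' = r @ q"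
      | r where "p' = p @ r" "q = r @ x # q'"
      by (auto simp: append_eq_append_conv2 append_eq_Cons_conv Cons_eq_append_conv)
    then show ?case
    proof cases
      case 1
      then obtain u1 u2 b c1 c2 where *: "u = u1 @ u2" "contracts wt (p' @ r) (u1 @ b) c1"
          "contracts wt q (inv_word b @ u2) c2" "c = c1 + c2"
        using letter.IH[of "p' @ r" q] by auto
      have "contracts wt p (u1 @ b) (c1 + wt_letter wt x)"
        using *(2) 1 by (auto intro: contracts.letter)
      moreover have "c + wt_letter wt x = (c1 + wt_letter wt x) + c2"
        using * by simp
      ultimately show ?thesis using * by blast
    next
      case 2
      then obtain u1 u2 b c1 c2 where *: "u = u1 @ u2" "contracts wt p (u1 @ b) c1"
          "contracts wt (r @ q') (inv_word b @ u2) c2" "c = c1 + c2"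
        using letter.IH[of p "r @ q'"] by auto
      have "contracts wt q (inv_word b @ u2) (c2 + wt_letter wt x)"
        using *(3) 2 by (auto intro: contracts.letter)
      moreover have "c + wt_letter wt x = c1 + (c2 + wt_letter wt x)"
        using * by simp
      ultimately show ?thesis using * by blast
    qed
  next
    case (pair p' q' u c x)
    from pair.prems consider r where "p = p' @ x # inv_letter x # r" "q' = r @ q"
      | r where "p' = p @ r" "q = r @ x # inv_letter x # q'"
      | "p = p' @ [x]" "q = inv_letter x # q'"
      by (auto simp: append_eq_append_conv2 append_eq_Cons_conv Cons_eq_append_conv)
    then show ?case
    proof cases
      case 1
      then obtain u1 u2 b c1 c2 where *: "u = u1 @ u2" "contracts wt (p' @ r) (u1 @ b) c1"
          "contracts wt q (inv_word b @ u2) c2" "c = c1 + c2"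
        using pair.IH[of "p' @ r" q] by auto
      then have "contracts wt p (u1 @ b) c1"
        using 1 by (auto intro: contracts.pair)
      then show ?thesis using * by blast
    next
      case 2
      then obtain u1 u2 b c1 c2 where *: "u = u1 @ u2" "contracts wt p (u1 @ b) c1"
          "contracts wt (r @ q') (inv_word b @ u2) c2" "c = c1 + c2"
        using pair.IH[of p "r @ q'"] by auto
      then have "contracts wt q (inv_word b @ u2) c2"
        using 2 by (auto intro: contracts.pair)
      then show ?thesis using * by blast
    next
      case 3
      obtain u1 u2 b c1 c2 where *: "u = u1 @ u2" "contracts wt p' (u1 @ b) c1"
          "contracts wt q' (inv_word b @ u2) c2" "c = c1 + c2"
        using pair.IH[of p' q'] by auto
      \<comment> \<open>The inserted pair straddles the cut. It is the innermost chord there, so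
        \<open>x\<close> is appended at the end of \<open>b\<close>.\<close>
      have "contracts wt p (u1 @ (b @ [x])) c1" "contracts wt q (inv_word (b @ [x]) @ u2) c2"
        using contracts_append_right[OF *(2), of "[x]"] contracts_append_left[OF *(3), of "[inv_letter x]"] 3
        by simp_all
      then show ?thesis using * by blast
    qed
  qed
  with assms that show thesis by blast
qed

section \<open>Deleting letters from a folded word\<close>

text \<open>If \<open>x\<close> is paired, its partner becomes unpaired, which costs
  \<open>wt_letter wt x\<close>. If \<open>x\<close> is unpaired, the cost does not rise, since
  weights are nonnegative.\<close>

lemma contracts_remove_letter:
  assumes nonneg: "\<forall>t. 0 \<le> wt t"
    and "contracts wt (p @ x # q) [] c"
  shows "\<exists>d \<le> c + wt_letter wt x. contracts wt (p @ q) [] d"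
proof -
  have pos: "0 \<le> wt_letter wt y" for y
    using nonneg by (cases y) (simp_all add: wt_letter_def)
  have "\<exists>d \<le> c + wt_letter wt x. contracts wt (p @ q) [] d"
    if "contracts wt l u c" "u = []" "l = p @ x # q" for l u
    using that
  proof (induction arbitrary: p q rule: contracts.induct)
    case (self u)
    then show ?case by simp
  next
    case (letter p' q' u c y)
    from letter.prems(2) consider "p' = p" "y = x" "q' = q"
      | r where "p = p' @ y # r" "q' = r @ x # q"
      | r where "p' = p @ x # r" "q = r @ y # q'"
      by (auto simp: append_eq_append_conv2 append_eq_Cons_conv Cons_eq_append_conv)
    then show ?case
    proof cases
      case 1
      then show ?thesis using letter.hyps letter.prems pos[of x]
        by (intro exI[of _ c]) auto
    next
      case 2
      then obtain d where "d \<le> c + wt_letter wt x" "contracts wt (p' @ r @ q) [] d"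
        using letter.IH[of "p' @ r" q] letter.prems by auto
      then show ?thesis using 2 contracts.letter[of wt p' "r @ q" "[]" d y]
        by (intro exI[of _ "d + wt_letter wt y"]) auto
    next
      case 3
      then obtain d where "d \<le> c + wt_letter wt x" "contracts wt ((p @ r) @ q') [] d"
        using letter.IH[of p "r @ q'"] letter.prems by auto
      then show ?thesis using 3 contracts.letter[of wt "p @ r" q' "[]" d y]
        by (intro exI[of _ "d + wt_letter wt y"]) auto
    qed
  next
    case (pair p' q' u c y)
    from pair.prems(2) consider "p' = p" "y = x" "q = inv_letter x # q'"
      | "p = p' @ [y]" "x = inv_letter y" "q' = q"
      | r where "p = p' @ y # inv_letter y # r" "q' = r @ x # q"
      | r where "p' = p @ x # r" "q = r @ y # inv_letter y # q'"
      by (auto simp: append_eq_append_conv2 append_eq_Cons_conv Cons_eq_append_conv)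
    then show ?case
    proof cases
      case 1
      then show ?thesis using pair contracts.letter[of wt p q' "[]" c "inv_letter x"]
        by (intro exI[of _ "c + wt_letter wt x"]) auto
    next
      case 2
      then show ?thesis using pair contracts.letter[of wt p' q' "[]" c y]
        by (intro exI[of _ "c + wt_letter wt x"]) auto
    next
      case 3
      then obtain d where "d \<le> c + wt_letter wt x" "contracts wt (p' @ r @ q) [] d"
        using pair.IH[of "p' @ r" q] pair.prems by auto
      then show ?thesis using 3 contracts.pair[of wt p' "r @ q" "[]" d y] by auto
    next
      case 4
      then obtain d where "d \<le> c + wt_letter wt x" "contracts wt ((p @ r) @ q') [] d"
        using pair.IH[of p "r @ q'"] pair.prems by auto
      then show ?thesis using 4 contracts.pair[of wt "p @ r" q' "[]" d y] by auto
    qed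
  qed
  with assms(2) show ?thesis by blast
qed

text \<open>Together with the rule \<open>pair\<close>, this makes the norm invariant under free
  cancellation. If only one of the two letters was unpaired, the weight saved on it pays for the
  abandoned partner of the other.\<close>

lemma contracts_remove_pair:
  assumes nonneg: "\<forall>t. 0 \<le> wt t"
    and "contracts wt (p @ x # inv_letter x # q) [] c"
  shows "\<exists>d \<le> c. contracts wt (p @ q) [] d"
proof -
  have "\<exists>d \<le> c. contracts wt (p @ q) [] d"
    if "contracts wt l u c" "u = []" "l = p @ x # inv_letter x # q" for l u
    using that
  proof (induction arbitrary: p q rule: contracts.induct)
    case (self u)
    then show ?case by simp
  next
    case (letter p' q' u c y)
    from letter.prems(2) consider "p' = p" "y = x" "q' = inv_letter x # q"
      | "p' = p @ [x]" "y = inv_letter x" "q' = q"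
      | r where "p = p' @ y # r" "q' = r @ x # inv_letter x # q"
      | r where "p' = p @ x # inv_letter x # r" "q = r @ y # q'"
      by (auto simp: append_eq_append_conv2 append_eq_Cons_conv Cons_eq_append_conv)
    then show ?case
    proof cases
      case 1
      then show ?thesis
        using contracts_remove_letter[OF nonneg, of p "inv_letter x" q c] letter by simp
    next
      case 2
      then show ?thesis
        using contracts_remove_letter[OF nonneg, of p x q c] letter by simp
    next
      case 3
      then obtain d where "d \<le> c" "contracts wt (p' @ r @ q) [] d"
        using letter.IH[of "p' @ r" q] letter.prems by auto
      then show ?thesis using 3 contracts.letter[of wt p' "r @ q" "[]" d y]
        by (intro exI[of _ "d + wt_letter wt y"]) auto
    next
      case 4
      then obtain d where "d \<le> c" "contracts wt ((p @ r) @ q') [] d"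
        using letter.IH[of p "r @ q'"] letter.prems by auto
      then show ?thesis using 4 contracts.letter[of wt "p @ r" q' "[]" d y]
        by (intro exI[of _ "d + wt_letter wt y"]) auto
    qed
  next
    case (pair p' q' u c y)
    \<comment> \<open>This alternative covers equal pairs and pairs sharing one letter: in
      \<open>x\<close>, \<open>inv_letter x\<close>, \<open>x\<close>, removing either adjacent pair
      leaves the same word.\<close>
    from pair.prems(2) consider "p' @ q' = p @ q"
      | r where "p = p' @ y # inv_letter y # r" "q' = r @ x # inv_letter x # q"
      | r where "p' = p @ x # inv_letter x # r" "q = r @ y # inv_letter y # q'"
      by (auto simp: append_eq_append_conv2 append_eq_Cons_conv Cons_eq_append_conv)
    then show ?case
    proof cases
      case 1
      then show ?thesis using pair by auto
    next
      case 2
      then obtain d where "d \<le> c" "contracts wt (p' @ r @ q) [] d"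
        using pair.IH[of "p' @ r" q] pair.prems by auto
      then show ?thesis using 2 contracts.pair[of wt p' "r @ q" "[]" d y] by auto
    next
      case 3
      then obtain d where "d \<le> c" "contracts wt ((p @ r) @ q') [] d"
        using pair.IH[of p "r @ q'"] pair.prems by auto
      then show ?thesis using 3 contracts.pair[of wt "p @ r" q' "[]" d y] by auto
    qed
  qed
  with assms(2) show ?thesis by blast
qed

section \<open>Equivalence of foldings and contractions\<close>

definition folding_cost :: "('a \<Rightarrow> real) \<Rightarrow> ('a + 'a) list \<Rightarrow> nat set set \<Rightarrow> real" where
  "folding_cost wt l F = (\<Sum>i\<in>unpaired l F. wt_letter wt (l ! i))"

lemma contracts_Cons: "contracts wt u [] c \<Longrightarrow> contracts wt (x # u) [] (c + wt_letter wt x)"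
  using contracts.letter[of wt "[]" u] by simp

lemma contracts_nested:
  assumes "contracts wt u [] c" "contracts wt v [] d"
  shows "contracts wt (x # u @ inv_letter x # v) [] (c + d)"
proof -
  have "contracts wt (x # u) [x] c"
    using contracts_append_left[OF assms(1), of "[x]"] by simp
  moreover have "contracts wt (inv_letter x # v) [inv_letter x] d"
    using contracts_append_left[OF assms(2), of "[inv_letter x]"] by simp
  ultimately show ?thesis
    using contracts_cancel[of wt "x # u" "[]" "[x]" c "inv_letter x # v" "[]" d] by simp
qed

text \<open>Induction on the length of the interval. The position \<open>a\<close> is either
  unpaired or has a partner \<open>j\<close>, and then the noncrossing condition makes the stretches
  before and after \<open>j\<close> closed under \<open>F\<close>. Working with intervals closed
  under \<open>F\<close> avoids renumbering positions.\<close>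

lemma folding_contracts_interval:
  assumes F: "folding l F"
    and "a \<le> b" "b \<le> length l" "\<And>P. P \<in> F \<Longrightarrow> P \<inter> {a..<b} \<noteq> {} \<Longrightarrow> P \<subseteq> {a..<b}"
  shows "contracts wt (map ((!) l) [a..<b]) [] (\<Sum>i\<in>{a..<b} - \<Union>F. wt_letter wt (l ! i))"
  using assms(2-)
proof (induction "b - a" arbitrary: a b rule: less_induct)
  case less
  show ?case
  proof (cases "a = b")
    case True
    then show ?thesis by (simp add: contracts.self)
  next
    case False
    with less.prems have "a < b" by simp
    show ?thesis
    proof (cases "a \<in> \<Union>F")
      case False
      have "contracts wt (map ((!) l) [Suc a..<b]) [] (\<Sum>i\<in>{Suc a..<b} - \<Union>F. wt_letter wt (l ! i))"
      proof (rule less.hyps)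
        fix P assume P: "P \<in> F" "P \<inter> {Suc a..<b} \<noteq> {}"
        then have "P \<inter> {a..<b} \<noteq> {}" by force
        with less.prems P have "P \<subseteq> {a..<b}" by blast
        moreover have "a \<notin> P" using False P by blast
        ultimately show "P \<subseteq> {Suc a..<b}"
          by (auto simp: Suc_le_eq order.strict_iff_order)
      qed (use less.prems \<open>a < b\<close> in auto)
      from contracts_Cons[OF this, of "l ! a"]
      have "contracts wt (map ((!) l) [a..<b]) []
          ((\<Sum>i\<in>{Suc a..<b} - \<Union>F. wt_letter wt (l ! i)) + wt_letter wt (l ! a))"
        using \<open>a < b\<close> by (simp add: upt_conv_Cons)
      moreover have "{a..<b} - \<Union>F = insert a ({Suc a..<b} - \<Union>F)"
        using False \<open>a < b\<close> by auto
      ultimately show ?thesis by (simp add: add.commute)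
    next
      case True
      then obtain P where P: "P \<in> F" "a \<in> P" by blast
      with F have "card P = 2" by (simp add: folding_def)
      with P obtain j where j: "P = {a, j}" "j \<noteq> a"
        by (metis card_2_iff doubleton_eq_iff insertE singletonD)
      have "P \<inter> {a..<b} \<noteq> {}" using P \<open>a < b\<close> by auto
      with less.prems P have "P \<subseteq> {a..<b}" by blast
      with j have ab: "a < j" "j < b" by auto
      have "{j, a} \<in> F" using P j by (simp add: insert_commute)
      with F have lj: "l ! j = inv_letter (l ! a)" unfolding folding_def by blast
      have sep: "Q \<subseteq> {Suc a..<j} \<or> Q \<subseteq> {Suc j..<b}"
        if Q: "Q \<in> F" "Q \<inter> {a..<b} \<noteq> {}" "Q \<noteq> P" for Q
      proof -
        have "card Q = 2" using F Q by (simp add: folding_def)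
        then obtain k r where "Q = {k, r}" "k \<noteq> r" by (metis card_2_iff)
        then obtain k r where kr: "Q = {k, r}" "k < r"
          by (metis insert_commute linorder_less_linear)
        have "disjnt P Q" using F Q P unfolding folding_def pairwise_def by blast
        moreover have "Q \<subseteq> {a..<b}" using less.prems Q by blast
        moreover have "\<not> linked P Q" using F Q P unfolding folding_def by blast
        moreover have "linked P Q" if "a < k" "k < j" "j < r"
          unfolding linked_def using that ab j kr by blast
        ultimately show ?thesis
          using ab j(1) kr by (auto simp: disjnt_def)
      qed
      have 1: "contracts wt (map ((!) l) [Suc a..<j]) [] (\<Sum>i\<in>{Suc a..<j} - \<Union>F. wt_letter wt (l ! i))"
      proof (rule less.hyps)
        fix Q assume Q: "Q \<in> F" "Q \<inter> {Suc a..<j} \<noteq> {}"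
        then have "Q \<noteq> P" using j by auto
        moreover have "Q \<inter> {a..<b} \<noteq> {}" using Q ab by force
        ultimately show "Q \<subseteq> {Suc a..<j}" using sep[of Q] Q by force
      qed (use less.prems ab in auto)
      have 2: "contracts wt (map ((!) l) [Suc j..<b]) [] (\<Sum>i\<in>{Suc j..<b} - \<Union>F. wt_letter wt (l ! i))"
      proof (rule less.hyps)
        fix Q assume Q: "Q \<in> F" "Q \<inter> {Suc j..<b} \<noteq> {}"
        then have "Q \<noteq> P" using j ab by auto
        moreover have "Q \<inter> {a..<b} \<noteq> {}" using Q ab by force
        ultimately show "Q \<subseteq> {Suc j..<b}" using sep[of Q] Q by force
      qed (use less.prems ab in auto)
      have "[a..<b] = a # [Suc a..<j] @ j # [Suc j..<b]"
        using ab by (metis less_imp_le_nat order_less_trans upt_add_eq_append[of "Suc a" j "b - j"]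
            le_add_diff_inverse Suc_leI upt_conv_Cons)
      moreover have "{a..<b} - \<Union>F = ({Suc a..<j} - \<Union>F) \<union> ({Suc j..<b} - \<Union>F)"
        using P j ab by (auto simp: not_less_eq_eq le_Suc_eq)
      moreover have "({Suc a..<j} - \<Union>F) \<inter> ({Suc j..<b} - \<Union>F) = {}" by auto
      ultimately show ?thesis
        using contracts_nested[OF 1 2, of "l ! a"] lj by (simp add: sum.union_disjoint)
    qed
  qed
qed

lemma folding_contracts: "folding l F \<Longrightarrow> contracts wt l [] (folding_cost wt l F)"
  using folding_contracts_interval[of l F 0 "length l" wt]
  by (simp add: map_nth folding_cost_def unpaired_def folding_def lessThan_atLeast0)

text \<open>This carries the noncrossing condition along an increasing renumbering of
  positions.\<close>

lemma linked_image:
  assumes f: "strict_mono f" and "linked (f ` P) (f ` Q)"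
  shows "linked P Q"
proof -
  obtain i j k r where *: "f ` P = {i, j}" "f ` Q = {k, r}" "i < j" "k < r"
      "i < k \<and> k < j \<and> j < r \<or> k < i \<and> i < r \<and> r < j"
    using assms(2) unfolding linked_def by blast
  have "i \<in> f ` P" "j \<in> f ` P" "k \<in> f ` Q" "r \<in> f ` Q" using * by auto
  then obtain i' j' k' r' where e: "i = f i'" "j = f j'" "k = f k'" "r = f r'" by blast
  have "f ` P = f ` {i', j'}" "f ` Q = f ` {k', r'}" using * e by auto
  then have "P = {i', j'}" "Q = {k', r'}"
    by (simp_all only: inj_image_eq_iff[OF strict_mono_imp_inj_on[OF f]])
  then show ?thesis
    using * e unfolding linked_def by (auto simp: strict_mono_less[OF f])
qed

text \<open>The shift \<open>f\<close> skips the positions of the block \<open>r\<close>, all of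
  which stay unpaired. It preserves the order of the old positions, so no chords become
  linked.\<close>

lemma folding_insert:
  fixes p q r :: "('a + 'a) list"
  assumes "folding (p @ q) F"
  defines "f \<equiv> \<lambda>i. if i < length p then i else i + length r"
  shows "folding (p @ r @ q) ((`) f ` F)"
    and "unpaired (p @ r @ q) ((`) f ` F) = f ` unpaired (p @ q) F \<union> {length p..<length p + length r}"
    and "folding_cost wt (p @ r @ q) ((`) f ` F) = folding_cost wt (p @ q) F + sum_list (map (wt_letter wt) r)"
proof -
  have f: "strict_mono f" unfolding f_def by (rule strict_monoI) auto
  note inj = strict_mono_imp_inj_on[OF f]
  have nth: "(p @ r @ q) ! f i = (p @ q) ! i" for i
    unfolding f_def by (auto simp: nth_append)
  have range: "{..<length (p @ r @ q)} = f ` {..<length (p @ q)} \<union> {length p..<length p + length r}"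
  proof (intro equalityI subsetI)
    fix i assume i: "i \<in> {..<length (p @ r @ q)}"
    show "i \<in> f ` {..<length (p @ q)} \<union> {length p..<length p + length r}"
    proof (cases "i < length p")
      case True
      then show ?thesis by (intro UnI1 image_eqI[of _ _ i]) (auto simp: f_def)
    next
      case False
      with i show ?thesis
        by (cases "i < length p + length r")
          (auto simp: f_def intro!: image_eqI[of _ _ "i - length r"])
    qed
  qed (auto simp: f_def)
  have disj: "f i \<notin> {length p..<length p + length r}" for i
    by (auto simp: f_def)
  note G = assms(1)[unfolded folding_def]
  show "folding (p @ r @ q) ((`) f ` F)"
    unfolding folding_def
  proof (intro conjI ballI allI impI)
    fix P assume "P \<in> (`) f ` F"
    then obtain P' where P: "P' \<in> F" "P = f ` P'" by blast
    then have "P' \<subseteq> {..<length (p @ q)}" using G by blast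
    then show "P \<subseteq> {..<length (p @ r @ q)}" unfolding range P by blast
    have "card P = card P'"
      unfolding P(2) by (rule card_image[OF inj_on_subset[OF inj subset_UNIV]])
    then show "card P = 2" using P(1) G by simp
  next
    show "pairwise disjnt ((`) f ` F)"
    proof (rule pairwise_imageI)
      fix P Q assume "P \<in> F" "Q \<in> F" "P \<noteq> Q"
      then have "P \<inter> Q = {}" using G by (simp add: pairwise_def disjnt_def)
      then show "disjnt (f ` P) (f ` Q)"
        by (simp add: disjnt_def image_Int[OF inj, symmetric])
    qed
  next
    fix i j assume "{i, j} \<in> (`) f ` F"
    then obtain P where P: "P \<in> F" "{i, j} = f ` P" by blast
    then obtain i' j' where ij: "i = f i'" "j = f j'"
      by (metis imageE insertI1 insertI2)
    then have "f ` {i', j'} = f ` P" using P by auto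
    then have "P = {i', j'}" by (simp only: inj_image_eq_iff[OF inj])
    with P G show "(p @ r @ q) ! i = inv_letter ((p @ r @ q) ! j)"
      unfolding ij nth by blast
  next
    fix P Q assume "P \<in> (`) f ` F" "Q \<in> (`) f ` F"
    then show "\<not> linked P Q" using G linked_image[OF f] by blast
  qed
  have U: "\<Union>((`) f ` F) = f ` \<Union>F" by blast
  show un: "unpaired (p @ r @ q) ((`) f ` F) = f ` unpaired (p @ q) F \<union> {length p..<length p + length r}"
    unfolding unpaired_def U range image_set_diff[OF inj] using disj by blast
  have "(\<Sum>i\<in>{length p..<length p + length r}. wt_letter wt ((p @ r @ q) ! i))
      = (\<Sum>i\<in>{0..<length r}. wt_letter wt (r ! i))"
    using sum.shift_bounds_nat_ivl[of "\<lambda>i. wt_letter wt ((p @ r @ q) ! i)" 0 "length p" "length r"]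
    by (simp add: nth_append add.commute)
  also have "\<dots> = sum_list (map (wt_letter wt) r)"
    by (simp add: sum_list_sum_nth)
  finally show "folding_cost wt (p @ r @ q) ((`) f ` F) =
      folding_cost wt (p @ q) F + sum_list (map (wt_letter wt) r)"
    unfolding folding_cost_def un
    by (subst sum.union_disjoint)
      (use disj in \<open>auto simp: sum.reindex[OF inj_on_subset[OF inj subset_UNIV]] nth unpaired_def\<close>)
qed

lemma folding_add_adjacent:
  assumes "folding l F" "i \<in> unpaired l F" "Suc i \<in> unpaired l F" "l ! Suc i = inv_letter (l ! i)"
  shows "folding l (insert {i, Suc i} F)"
    and "folding_cost wt l (insert {i, Suc i} F) = folding_cost wt l F - 2 * wt_letter wt (l ! i)"
proof -
  have u: "i \<notin> \<Union>F" "Suc i \<notin> \<Union>F" "Suc i < length l"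
    using assms by (auto simp: unpaired_def)
  \<comment> \<open>No position lies strictly between \<open>i\<close> and \<open>Suc i\<close>, so
    no chord can cross this one.\<close>
  have un: "\<not> linked {i, Suc i} Q" "\<not> linked Q {i, Suc i}" for Q
    unfolding linked_def by (auto simp: doubleton_eq_iff)
  show "folding l (insert {i, Suc i} F)"
    using assms(1,4) u un unfolding folding_def
    by (auto simp: doubleton_eq_iff pairwise_insert disjnt_def)
  have "unpaired l (insert {i, Suc i} F) = unpaired l F - {i, Suc i}"
    by (auto simp: unpaired_def)
  moreover have "finite (unpaired l F)" by (simp add: unpaired_def)
  ultimately show "folding_cost wt l (insert {i, Suc i} F) = folding_cost wt l F - 2 * wt_letter wt (l ! i)"
    using assms by (simp add: folding_cost_def sum_diff)
qed

lemma contracts_folding: "contracts wt l [] c \<Longrightarrow> \<exists>F. folding l F \<and> folding_cost wt l F = c"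
proof -
  have "\<exists>F. folding l F \<and> folding_cost wt l F = c" if "contracts wt l u c" "u = []" for u
    using that
  proof (induction rule: contracts.induct)
    case (self u)
    then show ?case
      by (intro exI[of _ "{}"]) (simp add: folding_def folding_cost_def unpaired_def)
  next
    case (letter p q u c x)
    then obtain F where "folding (p @ q) F" "folding_cost wt (p @ q) F = c" by blast
    with folding_insert(1,3)[OF this(1), where r = "[x]"] show ?case by auto
  next
    case (pair p q u c x)
    then obtain F where F: "folding (p @ q) F" "folding_cost wt (p @ q) F = c" by blast
    \<comment> \<open>Both letters are first inserted as unpaired. Pairing them afterwards refunds
      twice the weight of \<open>x\<close>.\<close>
    obtain F' where F': "folding (p @ x # inv_letter x # q) F'"
        "{length p..<length p + 2} \<subseteq> unpaired (p @ x # inv_letter x # q) F'"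
        "folding_cost wt (p @ x # inv_letter x # q) F' = c + 2 * wt_letter wt x"
      using folding_insert[OF F(1), where r = "[x, inv_letter x]"] F(2) by fastforce
    have "length p \<in> unpaired (p @ x # inv_letter x # q) F'"
        "Suc (length p) \<in> unpaired (p @ x # inv_letter x # q) F'"
      using F'(2) by auto
    from folding_add_adjacent[OF F'(1) this] F'(3) show ?case
      by (auto simp: nth_append)
  qed
  then show "contracts wt l [] c \<Longrightarrow> ?thesis" by blast
qed

section \<open>Properties of the word norm\<close>

text \<open>The translations in both directions show that the same costs are attained, so what
  follows can argue with contractions alone.\<close>

lemma word_norm_alt: "word_norm wt l = Min {c. contracts wt l [] c}"
proof -
  have "{c. contracts wt l [] c} = {\<Sum>i\<in>unpaired l F. wt_letter wt (l ! i) | F. folding l F}"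
    using contracts_folding[of wt l] folding_contracts[of l _ wt]
    unfolding folding_cost_def by blast
  then show ?thesis by (simp add: word_norm_def)
qed

text \<open>Finiteness is what lets \<open>Min\<close> be used as a true minimum. It holds because a
  word has finitely many foldings.\<close>

lemma finite_contracts: "finite {c. contracts wt l [] c}"
proof -
  have "{c. contracts wt l [] c} \<subseteq> folding_cost wt l ` Pow (Pow {..<length l})"
    using contracts_folding[of wt l] by (fastforce simp: folding_def)
  then show ?thesis by (rule finite_subset) simp
qed

lemma word_norm_le: "contracts wt l [] c \<Longrightarrow> word_norm wt l \<le> c"
  unfolding word_norm_alt using finite_contracts by (intro Min_le) auto

lemma contracts_Nil_ex: "\<exists>c. contracts wt l [] c"
  by (induction l) (blast intro: contracts.self contracts_Cons)+

lemma contracts_word_norm: "contracts wt l [] (word_norm wt l)"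
  unfolding word_norm_alt using Min_in[OF finite_contracts[of wt l]] contracts_Nil_ex[of wt l] by auto

lemma word_norm_append: "word_norm wt (u @ v) \<le> word_norm wt u + word_norm wt v"
  using contracts_append[OF contracts_word_norm contracts_word_norm] by (intro word_norm_le) fastforce

lemma word_norm_inv_word [simp]: "word_norm wt (inv_word u) = word_norm wt u"
proof -
  have "word_norm wt (inv_word v) \<le> word_norm wt v" for v
    using contracts_inv_word[OF contracts_word_norm[of wt v]] by (intro word_norm_le) simp
  from this[of u] this[of "inv_word u"] show ?thesis by simp
qed

lemma word_norm_contracts: "contracts wt v u c \<Longrightarrow> word_norm wt v \<le> word_norm wt u + c"
  using contracts_trans[OF _ contracts_word_norm] word_norm_le by (fastforce simp: add.commute)

text \<open>What remains of \<open>v\<close> after contraction cancels against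
  \<open>inv_word u\<close>.\<close>

lemma word_norm_dist: "contracts wt v u c \<Longrightarrow> word_norm wt (v @ inv_word u) \<le> c"
  using contracts_cancel[of wt v "[]" u c "inv_word u" "[]" 0] contracts.self[of wt "inv_word u"]
  by (intro word_norm_le) simp

lemma word_norm_remove_pair:
  assumes "\<forall>t. 0 \<le> wt t"
  shows "word_norm wt (p @ x # inv_letter x # q) = word_norm wt (p @ q)"
proof (rule antisym)
  show "word_norm wt (p @ x # inv_letter x # q) \<le> word_norm wt (p @ q)"
    by (intro word_norm_le contracts.pair contracts_word_norm)
  show "word_norm wt (p @ q) \<le> word_norm wt (p @ x # inv_letter x # q)"
    using contracts_remove_pair[OF assms contracts_word_norm] word_norm_le order_trans by metis
qed

lemma word_norm_remove_inverse:
  assumes "\<forall>t. 0 \<le> wt t"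
  shows "word_norm wt (p @ u @ inv_word u @ q) = word_norm wt (p @ q)"
proof (induction u arbitrary: q rule: rev_induct)
  case (snoc x u)
  then show ?case using word_norm_remove_pair[OF assms, of "p @ u" x "inv_word u @ q"] by simp
qed simp

lemma word_norm_free_eq:
  assumes "\<forall>t. 0 \<le> wt t" and "(u, v) \<in> free_eq T"
  shows "word_norm wt u = word_norm wt v"
  using assms(2)
  by (induction rule: free_eq.induct) (simp_all add: word_norm_remove_pair[OF assms(1)])

text \<open>Rotation is conjugation: \<open>q @ p\<close> cancels to the same element as
  \<open>q @ (p @ q) @ inv_word q\<close>. Folding \<open>p @ q\<close> away there leaves
  \<open>q\<close> next to its inverse.\<close>

lemma word_norm_rotate:
  assumes "\<forall>t. 0 \<le> wt t"
  shows "word_norm wt (p @ q) = word_norm wt (q @ p)"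
proof -
  have "word_norm wt (q @ p) \<le> word_norm wt (p @ q)" for p q
  proof -
    have "word_norm wt (q @ p) = word_norm wt (q @ (p @ q) @ inv_word q)"
      using word_norm_remove_inverse[OF assms, of "q @ p" q "[]"] by simp
    also have "\<dots> \<le> word_norm wt (p @ q)"
    proof (rule word_norm_le)
      have "contracts wt (q @ (p @ q)) q (word_norm wt (p @ q))"
        using contracts_append_left[OF contracts_word_norm, of wt q "p @ q"] by simp
      from contracts_cancel[of wt _ "[]", simplified, OF this, of "inv_word q" "[]" 0]
      show "contracts wt (q @ (p @ q) @ inv_word q) [] (word_norm wt (p @ q))"
        by (simp add: contracts.self)
    qed
    finally show ?thesis .
  qed
  then show ?thesis by (meson order_antisym)
qed

section \<open>The halving step and the induction\<close>

text \<open>Writing \<open>u @ u\<close> as the product of \<open>u @ inv_word v\<close> and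
  \<open>v @ u\<close> bounds its norm by \<open>c + d\<close>. The norm of \<open>v\<close> exceeds
  that of \<open>u\<close> by at most the smaller of \<open>c\<close> and \<open>d\<close>, hence by
  at most their mean, which gives the extra \<open>1 / 2\<close>.\<close>

lemma word_norm_square_step:
  assumes nonneg: "\<forall>t. 0 \<le> wt t" and "0 \<le> k"
    and "contracts wt v u c" "contracts wt v (inv_word u) d"
    and IH: "word_norm wt u \<le> k * word_norm wt (u @ u)"
  shows "word_norm wt v \<le> (k + 1 / 2) * (c + d)"
proof -
  have "word_norm wt (u @ u) = word_norm wt (u @ inv_word v @ v @ u)"
    using word_norm_remove_inverse[OF nonneg, of u "inv_word v" u] by simp
  also have "\<dots> \<le> word_norm wt (inv_word (v @ inv_word u)) + word_norm wt (v @ inv_word (inv_word u))"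
    using word_norm_append[of wt "u @ inv_word v" "v @ u"] by simp
  also have "\<dots> \<le> c + d"
    unfolding word_norm_inv_word by (intro add_mono word_norm_dist assms)
  finally have "k * word_norm wt (u @ u) \<le> k * (c + d)"
    using \<open>0 \<le> k\<close> by (rule mult_left_mono)
  moreover have "word_norm wt v \<le> word_norm wt u + c" "word_norm wt v \<le> word_norm wt u + d"
    using word_norm_contracts[OF assms(3)] word_norm_contracts[OF assms(4)] by simp_all
  ultimately show ?thesis using IH by (simp add: field_simps)
qed

text \<open>
  The four arcs are the factors of \<open>p @ q @ p @ q\<close>. In the proof, the words \<open>b\<close>, \<open>a\<close>, \<open>d\<close>, \<open>g\<close>
  collect the chords between neighbouring arcs, and \<open>h\<close> and \<open>k\<close> those between opposite arcs.
\<close>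

lemma contracts_squareE:
  assumes "contracts wt (p @ q @ p @ q) [] c" "length p \<le> n" "length q \<le> n"
  obtains v u c1 c2 where "v = p @ q \<or> v = q @ p" "length u \<le> n"
    "contracts wt v u c1" "contracts wt v (inv_word u) c2" "c = c1 + c2"
proof -
  note witness = that
  have fin: thesis
    if p: "contracts wt p (g @ h @ b) x1" and q: "contracts wt q (inv_word b @ k @ a) x2"
      and p': "contracts wt p (inv_word a @ inv_word h @ d) x3"
      and q': "contracts wt q (inv_word d @ inv_word k @ inv_word g) x4"
      \<comment> \<open>A chord between the two copies of \<open>p\<close> would cross one between
        the two copies of \<open>q\<close>. Since \<open>h\<close> or \<open>k\<close> is empty,
        these words also commute, which reconciles their orders in the inverses below.\<close>
      and hk: "h = [] \<or> k = []" and c: "c = x1 + x2 + x3 + x4"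
    for g h b k a d x1 x2 x3 x4
  proof -
    have "contracts wt (p @ q) (g @ h @ k @ a) (x1 + x2)"
      using contracts_cancel[of wt p "g @ h" b x1 q "k @ a" x2] p q by simp
    moreover have "contracts wt (p @ q) (inv_word (g @ h @ k @ a)) (x3 + x4)"
      using contracts_cancel[of wt p "inv_word a @ inv_word h" d x3 q "inv_word k @ inv_word g" x4] p' q' hk
      by auto
    moreover have "contracts wt (q @ p) (inv_word b @ k @ inv_word h @ d) (x2 + x3)"
      using contracts_cancel[of wt q "inv_word b @ k" a x2 p "inv_word h @ d" x3] q p' by simp
    moreover have "contracts wt (q @ p) (inv_word (inv_word b @ k @ inv_word h @ d)) (x4 + x1)"
      using contracts_cancel[of wt q "inv_word d @ inv_word k" "inv_word g" x4 p "h @ b" x1] q' p hk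
      by auto
    \<comment> \<open>If \<open>k\<close> is empty, the two lengths add up to the endpoints on the
      copies of \<open>p\<close>, at most \<open>2 * n\<close>. If \<open>h\<close> is empty, the
      same holds with the copies of \<open>q\<close>.\<close>
    moreover have "length (g @ h @ k @ a) \<le> n \<or> length (inv_word b @ k @ inv_word h @ d) \<le> n"
      using contracts_length[OF p] contracts_length[OF q] contracts_length[OF p']
        contracts_length[OF q'] hk assms(2,3) by auto
    moreover have "c = (x1 + x2) + (x3 + x4)" "c = (x2 + x3) + (x4 + x1)"
      using c by simp_all
    ultimately show thesis using witness by blast
  qed
  \<comment> \<open>The cut between the two copies of \<open>p @ q\<close> is the first diameter,
    and \<open>w\<close> collects the letters whose chords cross it.\<close>
  obtain w y1 y2 where w: "contracts wt (p @ q) w y1" "contracts wt (p @ q) (inv_word w) y2" "c = y1 + y2"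
    by (rule contracts_splitE[of wt "p @ q" "p @ q" "[]" c]) (use assms in auto)
  obtain w1 w2 b x1 x2 where split1: "w = w1 @ w2" "contracts wt p (w1 @ b) x1"
      "contracts wt q (inv_word b @ w2) x2" "y1 = x1 + x2"
    using w(1) by (rule contracts_splitE)
  obtain w3 w4 d x3 x4 where split2: "inv_word w = w3 @ w4" "contracts wt p (w3 @ d) x3"
      "contracts wt q (inv_word d @ w4) x4" "y2 = x3 + x4"
    using w(2) by (rule contracts_splitE)
  \<comment> \<open>The two half circles factor the same word \<open>w\<close> at possibly different
    places. The overlap is \<open>h\<close> or \<open>k\<close>, the chords between opposite
    arcs.\<close>
  have "w1 @ w2 = inv_word w4 @ inv_word w3"
    using split1(1) split2(1) by (metis inv_word_simps(3,4))
  then consider h where "w1 = inv_word w4 @ h" "inv_word w3 = h @ w2"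
    | k where "w1 @ k = inv_word w4" "w2 = k @ inv_word w3"
    by (auto simp: append_eq_append_conv2)
  then show thesis
  proof cases
    case 1
    then have "w3 = inv_word w2 @ inv_word h" by (metis inv_word_simps(3,4))
    then show thesis
      using fin[of "inv_word w4" h b x1 "[]" w2 x2 d x3 x4] 1 split1 split2 w by simp
  next
    case 2
    then have "w4 = inv_word k @ inv_word w1" by (metis inv_word_simps(3,4))
    then show thesis
      using fin[of w1 "[]" b x1 k "inv_word w3" x2 d x3 x4] 2 split1 split2 w by simp
  qed
qed

text \<open>A letter is never its own inverse, so no chord can join the two copies of
  \<open>x\<close>.\<close>

lemma word_norm_square_singleton:
  "2 * word_norm wt [x] \<le> word_norm wt [x, x]"
proof -
  have single: "u = [x] \<or> u = []" "u = [] \<Longrightarrow> word_norm wt [x] \<le> c" if "contracts wt [x] u c" for u c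
  proof -
    from that show "u = [x] \<or> u = []"
      by cases (auto simp: Cons_eq_append_conv dest: contracts_length)
    show "u = [] \<Longrightarrow> word_norm wt [x] \<le> c" using that word_norm_le by blast
  qed
  obtain b c d where *: "contracts wt [x] b c" "contracts wt [x] (inv_word b) d" "word_norm wt [x, x] = c + d"
    by (rule contracts_splitE[of wt "[x]" "[x]" "[]" "word_norm wt [x, x]"])
      (use contracts_word_norm[of wt "[x, x]"] in auto)
  then have "b = []"
    using single(1)[OF *(1)] single(1)[OF *(2)] inv_letter_neq[of x] by auto
  with single(2)[OF *(1)] single(2)[OF *(2)] *(3) show ?thesis by simp
qed

lemma word_norm_square:
  assumes nonneg: "\<forall>t. 0 \<le> wt t"
  shows "length u \<le> 2 ^ m \<Longrightarrow> word_norm wt u \<le> (real m + 1) / 2 * word_norm wt (u @ u)"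
proof (induction m arbitrary: u)
  case 0
  then consider "u = []" | x where "u = [x]"
    by (cases u) auto
  then show ?case
  proof cases
    case 1
    have "word_norm wt [] = 0"
      using contracts_word_norm[of wt "[]"] by (auto elim: contracts.cases)
    with 1 show ?thesis by simp
  next
    case 2
    then show ?thesis using word_norm_square_singleton[of wt x] by simp
  qed
next
  case (Suc m)
  \<comment> \<open>Both parts have length at most \<open>2 ^ m\<close>, so
    \<open>contracts_squareE\<close> yields a word to which the induction hypothesis
    applies.\<close>
  define p q where "p = take (2 ^ m) u" and "q = drop (2 ^ m) u"
  have pq: "u = p @ q" "length p \<le> 2 ^ m" "length q \<le> 2 ^ m"
    using Suc.prems by (auto simp: p_def q_def)
  have "contracts wt (p @ q @ p @ q) [] (word_norm wt (u @ u))"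
    using contracts_word_norm[of wt "u @ u"] pq(1) by simp
  then obtain v w c1 c2 where v: "v = p @ q \<or> v = q @ p" "length w \<le> 2 ^ m"
      "contracts wt v w c1" "contracts wt v (inv_word w) c2" "word_norm wt (u @ u) = c1 + c2"
    using pq(2,3) by (rule contracts_squareE)
  have "word_norm wt u = word_norm wt v"
    using v(1) pq(1) word_norm_rotate[OF nonneg, of p q] by auto
  \<comment> \<open>Each halving of the length bound adds \<open>1 / 2\<close> to the
    factor.\<close>
  also have "\<dots> \<le> ((real m + 1) / 2 + 1 / 2) * (c1 + c2)"
    by (rule word_norm_square_step[OF nonneg _ v(3,4) Suc.IH[OF v(2)]]) simp
  finally show ?case using v(5) by (simp add: field_simps)
qed

section \<open>Passage to the free group\<close>

text \<open>
  Weights may be negative outside \<open>T\<close>, so they are replaced by their absolute values there.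
\<close>

lemma word_norm_cong:
  assumes "u \<in> lists (letters T)" "\<And>t. t \<in> T \<Longrightarrow> wt t = wt' t"
  shows "word_norm wt u = word_norm wt' u"
proof -
  have "(\<Sum>i\<in>unpaired u F. wt_letter wt (u ! i)) = (\<Sum>i\<in>unpaired u F. wt_letter wt' (u ! i))" for F
  proof (rule sum.cong[OF HOL.refl])
    fix i assume "i \<in> unpaired u F"
    then have "u ! i \<in> letters T" using assms(1) by (auto simp: unpaired_def)
    then show "wt_letter wt (u ! i) = wt_letter wt' (u ! i)"
      using assms(2) by (auto simp: letters_def wt_letter_def)
  qed
  then show ?thesis by (simp add: word_norm_def)
qed

lemma cancellation_norm_word_class:
  assumes "\<forall>t\<in>T. 0 \<le> wt t" "u \<in> lists (letters T)"
  shows "cancellation_norm wt (word_class T u) = word_norm wt u"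
proof -
  define wt' where "wt' t = \<bar>wt t\<bar>" for t
  \<comment> \<open>This is the representative that \<open>cancellation_norm\<close> picks. It is
    freely equal to \<open>u\<close>, so invariance under \<open>free_eq\<close> compares the two
    norms.\<close>
  define v where "v = (SOME v. v \<in> word_class T u)"
  have "u \<in> word_class T u" using assms(2) by (simp add: word_class_def free_eq.refl)
  then have "v \<in> word_class T u" unfolding v_def by (rule someI)
  then have uv: "(u, v) \<in> free_eq T" by (simp add: word_class_def)
  then have "v \<in> lists (letters T)" using free_eq_in_lists by blast
  then have "word_norm wt v = word_norm wt' v"
    using assms(1) by (intro word_norm_cong) (auto simp: wt'_def)
  also have "\<dots> = word_norm wt' u"
    using word_norm_free_eq[of wt' u v T, OF _ uv] by (simp add: wt'_def)
  also have "\<dots> = word_norm wt u"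
    using assms by (intro word_norm_cong) (auto simp: wt'_def)
  finally show ?thesis by (simp add: cancellation_norm_def v_def)
qed

theorem theorem6p1:
  fixes T :: "'a set" and wt :: "'a \<Rightarrow> real" and m :: nat
    and w :: "('a + 'a) list set" and u :: "('a + 'a) list"
  assumes "\<And>t. t \<in> T \<Longrightarrow> 0 \<le> wt t"
    and "w \<in> carrier (free_group T)"
    and "u \<in> lists (letters T)" and "word_class T u = w" and "length u \<le> 2 ^ m"
  shows "cancellation_norm wt w
    \<le> (real m + 1) / 2 * cancellation_norm wt (w [^]\<^bsub>free_group T\<^esub> (2::nat))"
proof -
  have nonneg: "\<forall>t\<in>T. 0 \<le> wt t" using assms(1) by blast
  interpret group "free_group T" by (rule group_free_group)
  have "w [^]\<^bsub>free_group T\<^esub> (2::nat) = w \<otimes>\<^bsub>free_group T\<^esub> w"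
    using assms(2) by (simp add: numeral_2_eq_2)
  also have "\<dots> = word_class T (u @ u)"
    using mult_free_group[OF assms(3,3)] assms(4) by simp
  finally have "cancellation_norm wt (w [^]\<^bsub>free_group T\<^esub> (2::nat)) = word_norm wt (u @ u)"
    using cancellation_norm_word_class[OF nonneg, of "u @ u"] assms(3) by simp
  moreover have "cancellation_norm wt w = word_norm wt u"
    using cancellation_norm_word_class[OF nonneg, of u] assms(3,4) by simp
  moreover define wt' where "wt' t = \<bar>wt t\<bar>" for t
  have "word_norm wt v = word_norm wt' v" if "v \<in> lists (letters T)" for v
    using that assms(1) by (intro word_norm_cong) (auto simp: wt'_def)
  moreover have "word_norm wt' u \<le> (real m + 1) / 2 * word_norm wt' (u @ u)"
    using assms(5) by (intro word_norm_square) (simp_all add: wt'_def)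
  ultimately show ?thesis using assms(3) by simp
qed

end
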